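(* The class of interval graphs and the class of permutation graphs do not admit low rank-width colorings.
   Context: All graphs are finite and simple. An interval graph is the intersection graph of a family of intervals on the real line. A permutation graph is the intersection graph of line segments whose endpoints lie on two parallel lines. Rank-width: for a graph $G$ and $X\subseteq V(G)$, $\mathrm{cutrk}_G(X)$ is the rank over GF(2) of the adjacency submatrix with rows $X$ and columns $V(G)\setminus X$; a rank-decomposition is a tree with all nodes of degree 1 or 3 whose leaves are in bijection with $V(G)$, an edge $e$ has width $\mathrm{cutrk}_G$ of the vertex set on one side of $e$, and the rank-width is the minimum over rank-decompositions of the maximum edge width ($0$ for graphs with at most one vertex). A class $\mathcal{D}$ of graphs admits low rank-width colorings if there exist functions $N,Q\colon\mathbb{N}\to\mathbb{N}$ such that for all $p\in\mathbb{N}$, every $G\in\mathcal{D}$ can be vertex colored with at most $N(p)$ colors such that the union of any $i\le p$ color classes induces a subgraph of rank-width at most $Q(i)$. *)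

theory Defs
  imports "HOL-Analysis.Analysis" "HOL-Library.Z2" "HOL-Library.Function_Algebras"
begin

section \<open>Finite simple graphs\<close>

record 'a ugraph =
  verts :: "'a set"
  edges :: "'a set set"

definition simple_graph :: "'a ugraph \<Rightarrow> bool" where
  "simple_graph G \<longleftrightarrow>
     finite (verts G) \<and> (\<forall>e\<in>edges G. e \<subseteq> verts G \<and> card e = 2)"

definition adj :: "'a ugraph \<Rightarrow> ('a \<times> 'a) set" where
  "adj G = {(u, v). {u, v} \<in> edges G}"

definition induced :: "'a ugraph \<Rightarrow> 'a set \<Rightarrow> 'a ugraph" where
  "induced G U = \<lparr>verts = verts G \<inter> U, edges = {e \<in> edges G. e \<subseteq> U}\<rparr>"

definition delete_edge :: "'a ugraph \<Rightarrow> 'a set \<Rightarrow> 'a ugraph" where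
  "delete_edge G e = \<lparr>verts = verts G, edges = edges G - {e}\<rparr>"

definition degree :: "'a ugraph \<Rightarrow> 'a \<Rightarrow> nat" where
  "degree G v = card {e \<in> edges G. v \<in> e}"

definition connected_graph :: "'a ugraph \<Rightarrow> bool" where
  "connected_graph G \<longleftrightarrow>
     verts G \<noteq> {} \<and> (\<forall>u\<in>verts G. \<forall>v\<in>verts G. (u, v) \<in> (adj G)\<^sup>*)"

definition is_cycle :: "'a ugraph \<Rightarrow> 'a list \<Rightarrow> bool" where
  "is_cycle G c \<longleftrightarrow>
     length c \<ge> 3 \<and> distinct c \<and>
     successively (\<lambda>u v. (u, v) \<in> adj G) c \<and> (last c, hd c) \<in> adj G"

definition is_tree :: "'a ugraph \<Rightarrow> bool" where
  "is_tree T \<longleftrightarrow> simple_graph T \<and> connected_graph T \<and> (\<nexists>c. is_cycle T c)"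

definition leaves :: "'a ugraph \<Rightarrow> 'a set" where
  "leaves T = {t \<in> verts T. degree T t = 1}"


section \<open>Interval graphs and permutation graphs\<close>

definition is_intersection_graph :: "'a ugraph \<Rightarrow> ('a \<Rightarrow> 'b set) \<Rightarrow> bool" where
  "is_intersection_graph G S \<longleftrightarrow>
     (\<forall>u\<in>verts G. \<forall>v\<in>verts G. u \<noteq> v \<longrightarrow> ({u, v} \<in> edges G \<longleftrightarrow> S u \<inter> S v \<noteq> {}))"

definition interval_graph :: "'a ugraph \<Rightarrow> bool" where
  "interval_graph G \<longleftrightarrow> simple_graph G \<and>
     (\<exists>I :: 'a \<Rightarrow> real set.
        (\<forall>v\<in>verts G. is_interval (I v) \<and> I v \<noteq> {}) \<and> is_intersection_graph G I)"

text \<open>The two lines are \<open>{p + t *\<^sub>R d | t}\<close> and \<open>{q + t *\<^sub>R d | t}\<close>; they are distinct because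
  \<open>q - p\<close> is not a multiple of \<open>d\<close>. Each segment has one endpoint on each of them.\<close>

definition permutation_graph :: "'a ugraph \<Rightarrow> bool" where
  "permutation_graph G \<longleftrightarrow> simple_graph G \<and>
     (\<exists>(p :: real \<times> real) q d (a :: 'a \<Rightarrow> real) b.
        d \<noteq> 0 \<and> q - p \<notin> span {d} \<and>
        is_intersection_graph G (\<lambda>v. closed_segment (p + a v *\<^sub>R d) (q + b v *\<^sub>R d)))"


section \<open>Rank-width\<close>

text \<open>The type \<open>bit\<close> is the field GF(2). As for the rank of matrices in Cartesian space, the rank is
  the dimension of the row space. A row is a function on all of \<open>'b\<close> that vanishes outside the
  column set \<open>C\<close>, so that matrices with arbitrary finite row and column sets are covered.\<close>

definition gf2_scale :: "bit \<Rightarrow> ('b \<Rightarrow> bit) \<Rightarrow> ('b \<Rightarrow> bit)" where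
  "gf2_scale c f = (\<lambda>y. c * f y)"

lemma vector_space_gf2_scale: "vector_space gf2_scale"
  by unfold_locales (auto simp: gf2_scale_def fun_eq_iff algebra_simps)

definition gf2_rank :: "'a set \<Rightarrow> 'b set \<Rightarrow> ('a \<Rightarrow> 'b \<Rightarrow> bit) \<Rightarrow> nat" where
  "gf2_rank R C M =
     vector_space.dim gf2_scale ((\<lambda>x y. if y \<in> C then M x y else 0) ` R)"

definition cutrk :: "'a ugraph \<Rightarrow> 'a set \<Rightarrow> nat" where
  "cutrk G X = gf2_rank X (verts G - X) (\<lambda>x y. if (x, y) \<in> adj G then 1 else 0)"

text \<open>Every finite tree is isomorphic to one whose nodes are natural numbers.\<close>

definition rank_decomposition :: "'a ugraph \<Rightarrow> nat ugraph \<Rightarrow> ('a \<Rightarrow> nat) \<Rightarrow> bool" where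
  "rank_decomposition G T L \<longleftrightarrow>
     is_tree T \<and> (\<forall>t\<in>verts T. degree T t = 1 \<or> degree T t = 3) \<and>
     bij_betw L (verts G) (leaves T)"

definition side :: "'a ugraph \<Rightarrow> nat ugraph \<Rightarrow> ('a \<Rightarrow> nat) \<Rightarrow> nat \<Rightarrow> nat \<Rightarrow> 'a set" where
  "side G T L s t = {v \<in> verts G. (s, L v) \<in> (adj (delete_edge T {s, t}))\<^sup>*}"

text \<open>Each tree edge contributes the cut-rank of both of its sides; the two are equal because the
  rank of a matrix equals that of its transpose.\<close>

definition decomposition_width :: "'a ugraph \<Rightarrow> nat ugraph \<Rightarrow> ('a \<Rightarrow> nat) \<Rightarrow> nat" where
  "decomposition_width G T L = Max {cutrk G (side G T L s t) | s t. (s, t) \<in> adj T}"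

definition rankwidth :: "'a ugraph \<Rightarrow> nat" where
  "rankwidth G =
     (if card (verts G) \<le> 1 then 0
      else Inf {decomposition_width G T L | T L. rank_decomposition G T L})"


section \<open>Low rank-width colorings\<close>

text \<open>Colorings need not be proper. The color classes are the nonempty fibers of \<open>c\<close>, so a union of
  color classes is the preimage of a set \<open>I\<close> of used colors.\<close>

definition admits_low_rankwidth_colorings :: "'a ugraph set \<Rightarrow> bool" where
  "admits_low_rankwidth_colorings D \<longleftrightarrow>
     (\<exists>N Q :: nat \<Rightarrow> nat. \<forall>p. \<forall>G\<in>D. \<exists>c :: 'a \<Rightarrow> nat.
        card (c ` verts G) \<le> N p \<and>
        (\<forall>I \<subseteq> c ` verts G. card I \<le> p \<longrightarrow>
           rankwidth (induced G {v \<in> verts G. c v \<in> I}) \<le> Q (card I)))"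

end

theory Submission
  imports Defs "HOL-Library.Ramsey" "HOL-Library.Nat_Bijection"
begin

text \<open>
  One color class already suffices. Take the pairs \<open>a < b < m\<close> as vertices, either as the intervals
  \<open>[a, b]\<close> or as points of the plane that are adjacent when they form an inversion. By Ramsey's
  theorem a coloring with boundedly many colors has a color class containing all pairs from a large
  set, and by order invariance this class contains a \<open>k \<times> k\<close> grid of cells together with
  row comparators \<open>r\<^sub>t\<close>, adjacent to the cells \<open>(i, j)\<close> with \<open>i < t\<close>, and column comparators
  \<open>c\<^sub>t\<close>, adjacent to those with \<open>j < t\<close>. Every rank-decomposition has an edge that splits the row
  comparators evenly. If its cut-rank is small, then some row of cells lies on one side and
  another row on the other side, whereas some column lies on a single side: a contradiction.
\<close>

section \<open>Half graphs across a cut\<close>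

interpretation gf2: vector_space gf2_scale
  by (rule vector_space_gf2_scale)

text \<open>Over GF(2) a linear combination of a basis is a subset sum, so a span of dimension d has
  at most \<open>2 ^ d\<close> elements. This turns many distinct rows into large rank.\<close>

lemma card_le_two_power_gf2_dim:
  assumes "finite S"
  shows "card S \<le> 2 ^ gf2.dim S"
proof -
  obtain B where B: "B \<subseteq> S" "gf2.independent B" "S \<subseteq> gf2.span B" "card B = gf2.dim S"
    using gf2.basis_exists by blast
  have fin: "finite B" using B(1) assms finite_subset by blast
  have "gf2.span B \<subseteq> (\<lambda>C. \<Sum>v\<in>C. v) ` Pow B"
  proof
    fix w assume "w \<in> gf2.span B"
    then obtain u where u: "w = (\<Sum>v\<in>B. gf2_scale (u v) v)"
      using gf2.span_finite[OF fin] by auto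
    have "gf2_scale (u v) v = (if u v = 1 then v else 0)" for v
      by (cases "u v") (simp_all add: gf2_scale_def fun_eq_iff)
    then have "w = (\<Sum>v\<in>{v\<in>B. u v = 1}. v)"
      using u fin by (simp add: sum.inter_filter)
    then show "w \<in> (\<lambda>C. \<Sum>v\<in>C. v) ` Pow B" by blast
  qed
  then have "card S \<le> card ((\<lambda>C. \<Sum>v\<in>C. v) ` Pow B)"
    using B(3) fin by (meson card_mono finite_Pow_iff finite_imageI order_trans)
  also have "\<dots> \<le> card (Pow B)" using fin by (simp add: card_image_le)
  finally show ?thesis using B(4) fin by (simp add: card_Pow)
qed

text \<open>The vertices \<open>y l\<close> act as columns that tell the rows of the
  \<open>x i\<close> apart. Separation is asked only for \<open>i < j\<close>, the form in which a
  half graph supplies it.\<close>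

lemma card_le_two_power_cutrk:
  fixes A :: "'i::linorder set"
  assumes "finite X" "\<And>i. i \<in> A \<Longrightarrow> x i \<in> X" "\<And>i. i \<in> A \<Longrightarrow> y i \<in> verts G - X"
    and sep: "\<And>i j. i \<in> A \<Longrightarrow> j \<in> A \<Longrightarrow> i < j \<Longrightarrow>
      \<exists>l\<in>A. ((x i, y l) \<in> adj G) \<noteq> ((x j, y l) \<in> adj G)"
  shows "card A \<le> 2 ^ cutrk G X"
proof -
  define row where "row = (\<lambda>x y. if y \<in> verts G - X then (if (x, y) \<in> adj G then 1 else 0) else (0::bit))"
  have neq: "row (x i) \<noteq> row (x j)" if ij: "i \<in> A" "j \<in> A" "i < j" for i j
  proof -
    obtain l where "l \<in> A" "((x i, y l) \<in> adj G) \<noteq> ((x j, y l) \<in> adj G)"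
      using sep[OF ij] by blast
    then have "row (x i) (y l) \<noteq> row (x j) (y l)"
      using assms(3)[of l] by (auto simp: row_def)
    then show ?thesis by auto
  qed
  have "inj_on (\<lambda>i. row (x i)) A"
    by (rule linorder_inj_onI) (use neq in auto)
  then have "card A = card ((\<lambda>i. row (x i)) ` A)" by (simp add: card_image)
  also have "\<dots> \<le> card (row ` X)"
    using assms(1,2) by (intro card_mono) auto
  also have "\<dots> \<le> 2 ^ gf2.dim (row ` X)"
    by (rule card_le_two_power_gf2_dim) (use assms(1) in auto)
  finally show ?thesis by (simp add: cutrk_def gf2_rank_def row_def)
qed

lemma adj_sym: "(u, v) \<in> adj G \<longleftrightarrow> (v, u) \<in> adj G"
  by (simp add: adj_def insert_commute)

lemma adj_vertsD:
  assumes "simple_graph G" "(u, v) \<in> adj G"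
  shows "u \<in> verts G" "v \<in> verts G" "u \<noteq> v"
proof -
  have "{u, v} \<subseteq> verts G" "card {u, v} = 2" using assms by (auto simp: simple_graph_def adj_def)
  then show "u \<in> verts G" "v \<in> verts G" "u \<noteq> v" by auto
qed

text \<open>A comparator \<open>q t\<close> and a cell of row \<open>t\<close> on opposite sides of the cut, for many \<open>t\<close>,
  would form a large half graph across the cut.\<close>

lemma uniform_row:
  fixes k :: nat
  assumes "finite (verts G)" "X \<subseteq> verts G"
    and cell: "\<And>i j. i < k \<Longrightarrow> j < k \<Longrightarrow> cell i j \<in> verts G"
    and q: "\<And>t. t < k \<Longrightarrow> q t \<in> verts G"
    and adj: "\<And>i j t. i < k \<Longrightarrow> j < k \<Longrightarrow> t < k \<Longrightarrow> (cell i j, q t) \<in> adj G \<longleftrightarrow> i < t"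
    and large: "2 ^ cutrk G X < card {t. t < k \<and> (q t \<in> X \<longleftrightarrow> b)}"
  shows "\<exists>t<k. \<forall>j<k. cell t j \<in> X \<longleftrightarrow> b"
proof (rule ccontr)
  assume "\<not> ?thesis"
  \<comment> \<open>If no row is uniform, each row \<open>t\<close> has a cell
    \<open>cell t (f t)\<close> on the side opposite to \<open>b\<close>.\<close>
  then have "\<forall>t. \<exists>j. t < k \<longrightarrow> j < k \<and> (cell t j \<in> X \<longleftrightarrow> \<not> b)" by blast
  then obtain f where f: "\<And>t. t < k \<Longrightarrow> f t < k" "\<And>t. t < k \<Longrightarrow> cell t (f t) \<in> X \<longleftrightarrow> \<not> b"
    by metis
  have X: "finite X" using assms(1,2) finite_subset by blast
  define A where "A = {t. t < k \<and> (q t \<in> X \<longleftrightarrow> b)}"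
  have "card A \<le> 2 ^ cutrk G X"
  \<comment> \<open>Matrix rows must come from \<open>X\<close>: these are the comparators if
    \<open>b\<close> holds and the chosen cells otherwise. Since \<open>cell l (f l)\<close> is
    adjacent to \<open>q t\<close> exactly for \<open>l < t\<close>, the separating index is the
    smaller one in the first case and the larger one in the second.\<close>
  proof (cases b)
    case True
    show ?thesis
    proof (rule card_le_two_power_cutrk[of X A q "\<lambda>t. cell t (f t)"])
      fix i j assume "i \<in> A" "j \<in> A" "i < j"
      then show "\<exists>l\<in>A. ((q i, cell l (f l)) \<in> adj G) \<noteq> ((q j, cell l (f l)) \<in> adj G)"
        using adj f by (intro bexI[of _ i]) (auto simp: A_def adj_sym[of "q _"])
    qed (use X True q cell f in \<open>auto simp: A_def\<close>)
  next
    case False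
    show ?thesis
    proof (rule card_le_two_power_cutrk[of X A "\<lambda>t. cell t (f t)" q])
      fix i j assume "i \<in> A" "j \<in> A" "i < j"
      then show "\<exists>l\<in>A. ((cell i (f i), q l) \<in> adj G) \<noteq> ((cell j (f j), q l) \<in> adj G)"
        using adj f by (intro bexI[of _ j]) (auto simp: A_def)
    qed (use X False q cell f in \<open>auto simp: A_def\<close>)
  qed
  with large show False by (simp add: A_def)
qed


section \<open>Balanced edges of rank-decompositions\<close>

lemma adj_delete_edge: "(u, v) \<in> adj (delete_edge G e) \<longleftrightarrow> (u, v) \<in> adj G \<and> {u, v} \<noteq> e"
  by (auto simp: adj_def delete_edge_def)

lemma rtrancl_distinct_path:
  assumes "(x, y) \<in> r\<^sup>*"
  shows "\<exists>p. p \<noteq> [] \<and> hd p = x \<and> last p = y \<and> distinct p \<and> successively (\<lambda>u v. (u, v) \<in> r) p"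
  using assms
proof (induction rule: rtrancl_induct)
  case base
  show ?case by (rule exI[of _ "[x]"]) simp
next
  case (step y z)
  then obtain p where p: "p \<noteq> []" "hd p = x" "last p = y" "distinct p"
    "successively (\<lambda>u v. (u, v) \<in> r) p" by blast
  show ?case
  proof (cases "z \<in> set p")
    case True
    \<comment> \<open>The walk has returned to \<open>z\<close>, so the loop after the earlier visit
      is cut off.\<close>
    then obtain a b where ab: "p = (a @ [z]) @ b" by (metis split_list append_Cons append_Nil append_assoc)
    then have "successively (\<lambda>u v. (u, v) \<in> r) (a @ [z])"
      using p(5) by (metis successively_append_iff)
    then show ?thesis
      using p ab by (intro exI[of _ "a @ [z]"]) (cases a; auto)
  next
    case False
    show ?thesis
      using p step.hyps(2) False by (intro exI[of _ "p @ [z]"])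
        (auto simp: successively_append_iff)
  qed
qed

text \<open>A simple path from \<open>s\<close> to \<open>t\<close> avoiding the edge would close up
  with it to a cycle. The path has at least three nodes, because a path with two nodes is the
  deleted edge itself.\<close>

lemma tree_edge_is_bridge:
  assumes "is_tree T" "(s, t) \<in> adj T"
  shows "(s, t) \<notin> (adj (delete_edge T {s, t}))\<^sup>*"
proof
  assume "(s, t) \<in> (adj (delete_edge T {s, t}))\<^sup>*"
  then obtain p where p: "p \<noteq> []" "hd p = s" "last p = t" "distinct p"
    "successively (\<lambda>u v. (u, v) \<in> adj (delete_edge T {s, t})) p"
    using rtrancl_distinct_path by metis
  have "s \<noteq> t" using assms by (auto simp: is_tree_def dest: adj_vertsD)
  have "length p \<ge> 3"
  proof (rule ccontr)
    assume *: "\<not> ?thesis"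
    obtain a p' where a: "p = a # p'" using p(1) by (cases p) auto
    obtain b p'' where b: "p' = b # p''" using p a \<open>s \<noteq> t\<close> by (cases p') auto
    have "p'' = []" using * a b by (cases p'') auto
    then show False using p a b by (auto simp: adj_delete_edge)
  qed
  moreover have "successively (\<lambda>u v. (u, v) \<in> adj T) p"
    using p(5) by (rule successively_mono) (auto simp: adj_delete_edge)
  ultimately have "is_cycle T p"
    using p assms(2) by (auto simp: is_cycle_def adj_sym[of s])
  then show False using assms(1) by (auto simp: is_tree_def)
qed

text \<open>The component of \<open>s\<close> after deletion of the edge; \<open>side\<close>
  consists of the vertices of \<open>G\<close> whose leaves lie in it.\<close>

abbreviation branch :: "'a ugraph \<Rightarrow> 'a \<Rightarrow> 'a \<Rightarrow> 'a set" where
  "branch T s t \<equiv> {x. (s, x) \<in> (adj (delete_edge T {s, t}))\<^sup>*}"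

lemma branch_subset_verts:
  assumes "simple_graph T" "s \<in> verts T"
  shows "branch T s t \<subseteq> verts T"
proof
  fix x assume "x \<in> branch T s t"
  then have "(s, x) \<in> (adj (delete_edge T {s, t}))\<^sup>*" by simp
  then show "x \<in> verts T"
    using assms by (induction rule: rtrancl_induct) (auto simp: adj_delete_edge dest: adj_vertsD)
qed

text \<open>Along a walk from \<open>s\<close> the branch can change only when \<open>{s, t}\<close>
  is traversed, and each end of that edge lies in its own branch.\<close>

lemma branches_cover:
  assumes "connected_graph T" "s \<in> verts T" "x \<in> verts T"
  shows "x \<in> branch T s t \<or> x \<in> branch T t s"
proof -
  have "(s, x) \<in> (adj T)\<^sup>*" using assms by (auto simp: connected_graph_def)
  then show ?thesis
  proof (induction rule: rtrancl_induct)
    case (step y z)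
    show ?case
    proof (cases "{y, z} = {s, t}")
      case True
      then show ?thesis by (auto simp: doubleton_eq_iff)
    next
      case False
      then have "(y, z) \<in> adj (delete_edge T {s, t})" using step by (simp add: adj_delete_edge)
      then show ?thesis using step.IH by (auto simp: insert_commute intro: rtrancl_into_rtrancl)
    qed
  qed simp
qed

text \<open>The neighbour \<open>u\<close> is the one taken at the last departure from
  \<open>s\<close> on a walk to \<open>x\<close>; from there on the walk avoids
  \<open>{u, s}\<close>.\<close>

lemma branch_step:
  assumes "x \<in> branch T s t" "x \<noteq> s"
  shows "\<exists>u. (s, u) \<in> adj T \<and> u \<noteq> t \<and> x \<in> branch T u s"
proof -
  have "(s, x) \<in> (adj (delete_edge T {s, t}))\<^sup>*" using assms by simp
  then have "x = s \<or> (\<exists>u. (s, u) \<in> adj T \<and> u \<noteq> t \<and> x \<in> branch T u s)"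
  proof (induction rule: rtrancl_induct)
    case (step y z)
    have yz: "(y, z) \<in> adj T" "{y, z} \<noteq> {s, t}" using step by (auto simp: adj_delete_edge)
    show ?case
    proof (cases "y = s \<or> z = s")
      case True
      then show ?thesis using yz by auto
    next
      case False
      then obtain u where u: "(s, u) \<in> adj T" "u \<noteq> t" "y \<in> branch T u s" using step.IH by blast
      have "(y, z) \<in> adj (delete_edge T {u, s})" using yz False by (simp add: adj_delete_edge doubleton_eq_iff)
      then have "z \<in> branch T u s" using u(3) by (auto intro: rtrancl_into_rtrancl)
      then show ?thesis using u by blast
    qed
  qed simp
  then show ?thesis using assms by blast
qed

text \<open>As \<open>{u, s}\<close> is a bridge, a walk in the branch of \<open>u\<close> never
  meets \<open>s\<close> and hence never uses \<open>{s, t}\<close>. The node \<open>s\<close> makes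
  the inclusion strict. This drives the minimality argument for balanced edges.\<close>

lemma branch_psubset:
  assumes "is_tree T" "(s, u) \<in> adj T" "u \<noteq> t"
  shows "branch T u s \<subset> branch T s t"
proof -
  have s: "s \<notin> branch T u s"
    using tree_edge_is_bridge[of T u s] assms by (simp add: adj_sym)
  have "x \<in> branch T s t" if "x \<in> branch T u s" for x
  proof -
    have "(u, x) \<in> (adj (delete_edge T {u, s}))\<^sup>*" using that by simp
    then show ?thesis
    proof (induction rule: rtrancl_induct)
      case base
      show ?case using assms(2,3)
        by (auto simp: adj_delete_edge doubleton_eq_iff)
    next
      case (step y z)
      have "(u, z) \<in> (adj (delete_edge T {u, s}))\<^sup>*" using step.hyps by (rule rtrancl_into_rtrancl)
      then have "y \<noteq> s" "z \<noteq> s" using s step.hyps by auto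
      then have "(y, z) \<in> adj (delete_edge T {s, t})"
        using step.hyps by (simp add: adj_delete_edge doubleton_eq_iff)
      then show ?case using step.IH by (auto intro: rtrancl_into_rtrancl)
    qed
  qed
  moreover have "s \<in> branch T s t" by simp
  ultimately show ?thesis using s by blast
qed

lemma simple_graph_finite_edges: "simple_graph T \<Longrightarrow> finite (edges T)"
  by (rule finite_subset[of _ "Pow (verts T)"]) (auto simp: simple_graph_def)

lemma card_neighbours:
  assumes "simple_graph T"
  shows "finite {u. (s, u) \<in> adj T}" "card {u. (s, u) \<in> adj T} \<le> degree T s"
proof -
  have "finite (edges T)" using assms by (rule simple_graph_finite_edges)
  moreover have "inj_on (\<lambda>u. {s, u}) {u. (s, u) \<in> adj T}"
    by (auto simp: inj_on_def doubleton_eq_iff)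
  moreover have "(\<lambda>u. {s, u}) ` {u. (s, u) \<in> adj T} \<subseteq> {e \<in> edges T. s \<in> e}"
    by (auto simp: adj_def)
  ultimately show "card {u. (s, u) \<in> adj T} \<le> degree T s"
    unfolding degree_def by (intro card_inj_on_le) auto
  show "finite {u. (s, u) \<in> adj T}"
    by (rule finite_subset[of _ "verts T"])
      (use assms adj_vertsD[OF assms] in \<open>auto simp: simple_graph_def\<close>)
qed

text \<open>Among the arcs \<open>(s, t)\<close> with more than \<open>B\<close> leaves of \<open>W\<close> behind \<open>s\<close>, one with the smallest
  branch is balanced: each of the at most two branches beyond \<open>s\<close> contains at most \<open>B\<close> of them.\<close>

lemma balanced_tree_edge:
  assumes dec: "rank_decomposition G T L"
    and W: "finite W" "W \<subseteq> verts G" "3 * B + 2 \<le> card W"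
  shows "\<exists>s t. (s, t) \<in> adj T \<and> B < card (W \<inter> side G T L s t) \<and> B < card (W - side G T L s t)"
proof -
  have tree: "is_tree T" and deg: "\<And>x. x \<in> verts T \<Longrightarrow> degree T x = 1 \<or> degree T x = 3"
    and L: "bij_betw L (verts G) (leaves T)"
    using dec by (auto simp: rank_decomposition_def)
  have simp: "simple_graph T" and conn: "connected_graph T" using tree by (auto simp: is_tree_def)
  have fT: "finite (verts T)" using simp by (simp add: simple_graph_def)
  have side: "W \<inter> side G T L s t = {v \<in> W. L v \<in> branch T s t}" for s t
    using W(2) by (auto simp: side_def)
  have LT: "L v \<in> verts T" if "v \<in> W" for v
    using L W(2) that by (auto simp: bij_betw_def leaves_def)
  define big where "big = {(s, t). (s, t) \<in> adj T \<and> B < card (W \<inter> side G T L s t)}"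
  \<comment> \<open>A leaf supplies some tree edge. Its two sides cover \<open>W\<close>, and
    \<open>card W\<close> exceeds \<open>2 * B\<close>, so one of its two orientations is
    big.\<close>
  have "big \<noteq> {}"
  proof -
    obtain v where "v \<in> W" using W(3) by fastforce
    then have "L v \<in> leaves T" using L W(2) by (auto simp: bij_betw_def)
    then have "card {e \<in> edges T. L v \<in> e} = 1" by (simp add: leaves_def degree_def)
    then obtain e where e: "e \<in> edges T" by (metis (no_types, lifting) card_1_singletonE mem_Collect_eq singletonI)
    then have "card e = 2" using simp by (auto simp: simple_graph_def)
    then obtain s t where st: "(s, t) \<in> adj T" using e by (auto simp: card_2_iff adj_def)
    have "W \<subseteq> (W \<inter> side G T L s t) \<union> (W \<inter> side G T L t s)"
    proof
      fix v assume v: "v \<in> W"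
      show "v \<in> (W \<inter> side G T L s t) \<union> (W \<inter> side G T L t s)"
        using branches_cover[OF conn _ LT[OF v], of s t] adj_vertsD[OF simp st] v unfolding side by blast
    qed
    then have "card W \<le> card ((W \<inter> side G T L s t) \<union> (W \<inter> side G T L t s))"
      using W(1) by (intro card_mono) auto
    also have "\<dots> \<le> card (W \<inter> side G T L s t) + card (W \<inter> side G T L t s)" by (rule card_Un_le)
    finally have "B < card (W \<inter> side G T L s t) \<or> B < card (W \<inter> side G T L t s)" using W(3) by linarith
    then have "(s, t) \<in> big \<or> (t, s) \<in> big" using st by (auto simp: big_def adj_sym[of t s])
    then show ?thesis by blast
  qed
  then obtain st0 where "st0 \<in> big" by blast
  then obtain st where "st \<in> big"
    and "\<forall>z. z \<in> big \<longrightarrow> card (branch T (fst st) (snd st)) \<le> card (branch T (fst z) (snd z))"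
    using ex_has_least_nat[of "\<lambda>z. z \<in> big" st0 "\<lambda>z. card (branch T (fst z) (snd z))"] by blast
  then obtain s t where st: "(s, t) \<in> big"
    and min: "\<And>u w. (u, w) \<in> big \<Longrightarrow> card (branch T s t) \<le> card (branch T u w)"
    by (cases st) fastforce
  have adj: "(s, t) \<in> adj T" using st by (simp add: big_def)
  note sT = adj_vertsD[OF simp adj]
  define U where "U = {u. (s, u) \<in> adj T} - {t}"
  have U: "finite U" "card U \<le> 2"
  proof -
    show "finite U" using card_neighbours[OF simp] by (simp add: U_def)
    have "card {u. (s, u) \<in> adj T} \<le> 3" using card_neighbours(2)[OF simp, of s] deg[OF sT(1)] by auto
    then show "card U \<le> 2" using adj card_neighbours(1)[OF simp, of s] by (simp add: U_def)
  qed
  \<comment> \<open>Otherwise \<open>(u, s)\<close> would be a big arc with a strictly smaller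
    branch.\<close>
  have small: "card (W \<inter> side G T L u s) \<le> B" if u: "u \<in> U" for u
  proof (rule ccontr)
    assume "\<not> ?thesis"
    then have "(u, s) \<in> big" using u by (auto simp: big_def U_def adj_sym)
    moreover have "card (branch T u s) < card (branch T s t)"
      using u branch_psubset[OF tree, of s u t] branch_subset_verts[OF simp sT(1), of t] fT
      by (intro psubset_card_mono) (auto simp: U_def intro: finite_subset)
    ultimately show False using min by fastforce
  qed
  have "W \<inter> side G T L s t \<subseteq> {v \<in> W. L v = s} \<union> (\<Union>u\<in>U. W \<inter> side G T L u s)"
  proof
    fix v assume "v \<in> W \<inter> side G T L s t"
    then have v: "v \<in> W" "L v \<in> branch T s t" unfolding side by auto
    show "v \<in> {v \<in> W. L v = s} \<union> (\<Union>u\<in>U. W \<inter> side G T L u s)"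
      using branch_step[OF v(2)] v(1) unfolding side U_def by blast
  qed
  then have "card (W \<inter> side G T L s t) \<le> card ({v \<in> W. L v = s} \<union> (\<Union>u\<in>U. W \<inter> side G T L u s))"
    using W(1) U(1) by (intro card_mono) auto
  also have "\<dots> \<le> card {v \<in> W. L v = s} + card (\<Union>u\<in>U. W \<inter> side G T L u s)" by (rule card_Un_le)
  \<comment> \<open>The node \<open>s\<close> may itself be a leaf. With the two branches this gives
    at most \<open>2 * B + 1\<close> elements, which is why \<open>3 * B + 2\<close> leaves more
    than \<open>B\<close> for the other side.\<close>
  also have "card {v \<in> W. L v = s} \<le> 1"
  proof -
    have "inj_on L W" using L W(2) by (auto simp: bij_betw_def intro: inj_on_subset)
    then show ?thesis using W(1) by (auto simp: card_le_Suc0_iff_eq inj_on_def)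
  qed
  also have "card (\<Union>u\<in>U. W \<inter> side G T L u s) \<le> (\<Sum>u\<in>U. card (W \<inter> side G T L u s))"
    by (rule card_UN_le[OF U(1)])
  also have "\<dots> \<le> (\<Sum>u\<in>U. B)" by (rule sum_mono) (rule small)
  also have "\<dots> \<le> 2 * B" using U(2) by simp
  finally have "card (W \<inter> side G T L s t) \<le> 1 + 2 * B" by simp
  moreover have "card W = card (W \<inter> side G T L s t) + card (W - side G T L s t)"
    using W(1) by (metis card_Int_Diff)
  ultimately have "B < card (W - side G T L s t)" using W(3) by linarith
  then show ?thesis using st by (auto simp: big_def)
qed


section \<open>Existence of rank-decompositions\<close>

lemma cycle_cyclic_adj:
  assumes "is_cycle G c" "i < length c"
  shows "(c ! i, c ! (Suc i mod length c)) \<in> adj G"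
proof (cases "Suc i < length c")
  case True
  then show ?thesis using assms by (auto simp: is_cycle_def dest: successively_nth)
next
  case False
  then have "Suc i = length c" using assms by simp
  moreover have "c \<noteq> []" using assms by auto
  ultimately have "c ! i = last c" "c ! (Suc i mod length c) = hd c"
    by (auto simp: last_conv_nth hd_conv_nth simp flip: \<open>Suc i = length c\<close>)
  then show ?thesis using assms by (simp add: is_cycle_def)
qed

text \<open>These are the predecessor and the successor on the cycle, distinct because its length is
  at least 3. Hence a pendant node lies on no cycle.\<close>

lemma cycle_two_neighbours:
  assumes "is_cycle G c" "y \<in> set c"
  shows "\<exists>u v. u \<noteq> v \<and> (u, y) \<in> adj G \<and> (y, v) \<in> adj G"
proof -
  let ?n = "length c"
  have n: "3 \<le> ?n" "distinct c" using assms(1) by (auto simp: is_cycle_def)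
  obtain i where i: "i < ?n" "c ! i = y" using assms(2) by (auto simp: in_set_conv_nth)
  \<comment> \<open>The cyclic predecessor of position \<open>i\<close>.\<close>
  define h where "h = (if i = 0 then ?n - 1 else i - 1)"
  have h: "h < ?n" "Suc h mod ?n = i" using i n by (auto simp: h_def)
  have "h \<noteq> Suc i mod ?n"
    using i n by (cases "Suc i < ?n") (auto simp: h_def mod_Suc split: if_splits)
  then have "c ! h \<noteq> c ! (Suc i mod ?n)"
    using n h(1) by (subst nth_eq_iff_index_eq) (auto intro: mod_less_divisor)
  then show ?thesis
    using cycle_cyclic_adj[OF assms(1) h(1)] cycle_cyclic_adj[OF assms(1) i(1)] h(2) i(2) by metis
qed

definition add_pendant :: "'a ugraph \<Rightarrow> 'a \<Rightarrow> 'a \<Rightarrow> 'a ugraph" where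
  "add_pendant T x y = \<lparr>verts = insert y (verts T), edges = insert {x, y} (edges T)\<rparr>"

lemma adj_add_pendant:
  "(u, v) \<in> adj (add_pendant T x y) \<longleftrightarrow> (u, v) \<in> adj T \<or> {u, v} = {x, y}"
  by (auto simp: adj_def add_pendant_def)

text \<open>A cycle through \<open>y\<close> would give \<open>y\<close> two neighbours, and a cycle
  avoiding \<open>y\<close> would already be one of \<open>T\<close>.\<close>

lemma is_tree_add_pendant:
  assumes T: "is_tree T" and x: "x \<in> verts T" and y: "y \<notin> verts T"
  shows "is_tree (add_pendant T x y)"
proof -
  have simp: "simple_graph T" and conn: "connected_graph T" and acyc: "\<And>c. \<not> is_cycle T c"
    using T by (auto simp: is_tree_def)
  let ?T = "add_pendant T x y"
  have "x \<noteq> y" using x y by auto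
  then have "simple_graph ?T" using simp x by (auto simp: simple_graph_def add_pendant_def)
  moreover have "connected_graph ?T"
  proof -
    have mono: "(adj T)\<^sup>* \<subseteq> (adj ?T)\<^sup>*" by (rule rtrancl_mono) (auto simp: adj_add_pendant)
    have "(u, x) \<in> (adj ?T)\<^sup>* \<and> (x, u) \<in> (adj ?T)\<^sup>*" if "u \<in> verts ?T" for u
    proof (cases "u = y")
      case True
      then show ?thesis by (auto simp: adj_add_pendant insert_commute)
    next
      case False
      then have "u \<in> verts T" using that by (simp add: add_pendant_def)
      then show ?thesis using conn x mono by (auto simp: connected_graph_def)
    qed
    then show ?thesis
      unfolding connected_graph_def by (metis rtrancl_trans add_pendant_def insert_iff empty_iff select_convs(1))
  qed
  moreover have "\<not> is_cycle ?T c" for c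
  proof
    assume c: "is_cycle ?T c"
    have yT: "(u, y) \<notin> adj T" "(y, u) \<notin> adj T" for u using y simp by (auto dest: adj_vertsD)
    show False
    proof (cases "y \<in> set c")
      case True
      then obtain u v where "u \<noteq> v" "(u, y) \<in> adj ?T" "(y, v) \<in> adj ?T"
        using cycle_two_neighbours[OF c] by blast
      then show False using yT by (auto simp: adj_add_pendant doubleton_eq_iff)
    next
      case False
      have "c \<noteq> []" using c by (auto simp: is_cycle_def)
      then have "last c \<noteq> y" "hd c \<noteq> y" using False by (metis last_in_set, metis hd_in_set)
      moreover have "successively (\<lambda>u v. (u, v) \<in> adj T) c"
      proof (rule successively_mono)
        show "successively (\<lambda>u v. (u, v) \<in> adj ?T) c" using c by (simp add: is_cycle_def)
      qed (use False in \<open>auto simp: adj_add_pendant doubleton_eq_iff\<close>)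
      ultimately have "is_cycle T c"
        using c by (auto simp: is_cycle_def adj_add_pendant doubleton_eq_iff)
      then show False using acyc by blast
    qed
  qed
  ultimately show ?thesis by (simp add: is_tree_def)
qed

lemma degree_add_pendant:
  assumes "simple_graph T" "x \<in> verts T" "y \<notin> verts T"
  shows "degree (add_pendant T x y) v =
    (if v = y then 1 else if v = x then Suc (degree T v) else degree T v)"
proof -
  have e: "{x, y} \<notin> edges T" and ey: "\<And>e. e \<in> edges T \<Longrightarrow> y \<notin> e"
    using assms by (auto simp: simple_graph_def)
  have "{e \<in> edges (add_pendant T x y). v \<in> e} =
    (if v = x \<or> v = y then insert {x, y} {e \<in> edges T. v \<in> e} else {e \<in> edges T. v \<in> e})"
    by (auto simp: add_pendant_def)
  moreover have "finite {e \<in> edges T. v \<in> e}" using simple_graph_finite_edges[OF assms(1)] by simp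
  moreover have "{e \<in> edges T. y \<in> e} = {}" using ey by auto
  ultimately show ?thesis using e assms(2,3) by (auto simp: degree_def)
qed

text \<open>A lower bound on every decomposition width bounds the infimum in
  \<open>rankwidth\<close> only if some decomposition exists. Starting from a single edge, two
  pendant nodes are attached to a leaf: its degree rises from 1 to 3 and the number of leaves grows
  by one.\<close>

lemma rank_decomposition_exists:
  fixes G :: "'a ugraph"
  assumes "finite (verts G)" "2 \<le> card (verts G)"
  shows "\<exists>T L. rank_decomposition G T L"
proof -
  have "\<exists>(T :: nat ugraph) L. is_tree T \<and> (\<forall>t\<in>verts T. degree T t = 1 \<or> degree T t = 3) \<and> bij_betw L V (leaves T)"
    if "card V = Suc (Suc n)" for n and V :: "'a set"
    using that
  proof (induction n arbitrary: V)
    case 0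
    then obtain a b where V: "V = {a, b}" "a \<noteq> b"
      using card_2_iff[of V] by (auto simp: numeral_2_eq_2)
    define T0 :: "nat ugraph" where "T0 = \<lparr>verts = {0}, edges = {}\<rparr>"
    have cyc: "\<not> is_cycle T0 c" for c
    proof
      assume c: "is_cycle T0 c"
      then have "hd c \<in> set c" by (cases c) (auto simp: is_cycle_def)
      then show False using cycle_two_neighbours[OF c] by (auto simp: T0_def adj_def)
    qed
    have simp: "simple_graph T0" by (simp add: simple_graph_def T0_def)
    have "is_tree T0" using cyc simp by (auto simp: is_tree_def T0_def connected_graph_def)
    then have tree: "is_tree (add_pendant T0 0 1)" by (rule is_tree_add_pendant) (auto simp: T0_def)
    have deg: "degree (add_pendant T0 0 1) t = 1" if "t \<in> {0, 1}" for t
      using that by (subst degree_add_pendant[OF simp]) (auto simp: T0_def degree_def)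
    then have leaves: "leaves (add_pendant T0 0 1) = {0, 1}"
      by (auto simp: leaves_def add_pendant_def T0_def)
    have "bij_betw (\<lambda>v. if v = a then 0 else 1) V (leaves (add_pendant T0 0 1))"
      unfolding leaves using V by (auto simp: bij_betw_def inj_on_def)
    moreover have "verts (add_pendant T0 0 1) = {0, 1}" by (auto simp: add_pendant_def T0_def)
    ultimately show ?case using tree deg
      by (intro exI[of _ "add_pendant T0 0 1"] exI[of _ "\<lambda>v. if v = a then 0 else 1"] conjI) auto
  next
    case (Suc n)
    have fV: "finite V" using Suc.prems by (metis card.infinite nat.distinct(1))
    obtain w V' where V: "V = insert w V'" "w \<notin> V'" "card V' = Suc (Suc n)"
      using Suc.prems by (metis card_Suc_eq)
    obtain T :: "nat ugraph" and L where T: "is_tree T" "\<And>t. t \<in> verts T \<Longrightarrow> degree T t = 1 \<or> degree T t = 3"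
      and L: "bij_betw L V' (leaves T)"
      using Suc.IH[OF V(3)] by blast
    obtain v where v: "v \<in> V'" using V(3) by fastforce
    have simp: "simple_graph T" using T by (simp add: is_tree_def)
    then have fT: "finite (verts T)" by (simp add: simple_graph_def)
    define x where "x = L v"
    have xl: "x \<in> leaves T" using L v by (auto simp: x_def bij_betw_def)
    then have x: "x \<in> verts T" "degree T x = 1" by (auto simp: leaves_def)
    obtain y where y: "y \<notin> verts T" using fT ex_new_if_finite infinite_UNIV_nat by blast
    obtain z where z: "z \<notin> insert y (verts T)"
      using fT ex_new_if_finite[of "insert y (verts T)"] infinite_UNIV_nat by auto
    define T1 where "T1 = add_pendant T x y"
    define T2 where "T2 = add_pendant T1 x z"
    have vT1: "verts T1 = insert y (verts T)" and vT2: "verts T2 = insert z (insert y (verts T))"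
      by (auto simp: T1_def T2_def add_pendant_def)
    have T1: "is_tree T1" unfolding T1_def by (rule is_tree_add_pendant[OF T(1) x(1) y])
    have T2: "is_tree T2" unfolding T2_def by (rule is_tree_add_pendant[OF T1]) (use x z vT1 in auto)
    have deg: "degree T2 t = (if t = z \<or> t = y then 1 else if t = x then 3 else degree T t)" for t
    proof -
      have "simple_graph T1" using T1 by (simp add: is_tree_def)
      moreover have "x \<noteq> y" "x \<noteq> z" "z \<noteq> y" using x y z by auto
      ultimately show ?thesis
        unfolding T2_def using x y z vT1
        by (subst degree_add_pendant) (auto simp: T1_def degree_add_pendant[OF simp x(1) y])
    qed
    have leaves: "leaves T2 = insert z (insert y (leaves T - {x}))"
      using y z by (auto simp: leaves_def vT2 deg)
    have "bij_betw L (V' - {v}) (leaves T - {x})"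
      using L v unfolding x_def bij_betw_def inj_on_def by auto
    \<comment> \<open>The vertex \<open>v\<close> loses its leaf \<open>x\<close>, which becomes an
      inner node; it moves to \<open>y\<close>, and the new vertex \<open>w\<close> gets
      \<open>z\<close>.\<close>
    moreover define L' where "L' = L(v := y, w := z)"
    ultimately have "bij_betw L' (V' - {v}) (leaves T - {x})"
      by (subst bij_betw_cong[of _ L' L]) (use V(2) in auto)
    then have "bij_betw L' (V' - {v} \<union> {v}) (leaves T - {x} \<union> {L' v})"
      by (rule notIn_Un_bij_betw[rotated 2]) (use V(2) v y in \<open>auto simp: L'_def leaves_def\<close>)
    then have "bij_betw L' (V' - {v} \<union> {v} \<union> {w}) (leaves T - {x} \<union> {L' v} \<union> {L' w})"
      by (rule notIn_Un_bij_betw[rotated 2]) (use V(2) v y z in \<open>auto simp: L'_def leaves_def\<close>)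
    moreover have "V' - {v} \<union> {v} \<union> {w} = V" using v V(1) by auto
    moreover have "leaves T - {x} \<union> {L' v} \<union> {L' w} = leaves T2"
      using v V(2) by (auto simp: leaves L'_def)
    ultimately have "bij_betw L' V (leaves T2)" by simp
    moreover have "\<forall>t\<in>verts T2. degree T2 t = 1 \<or> degree T2 t = 3"
      using T(2) by (simp add: deg vT2)
    ultimately show ?case using T2 by blast
  qed
  from this[of "verts G" "card (verts G) - 2"] show ?thesis
    using assms by (simp add: rank_decomposition_def)
qed


section \<open>Rank-width of comparator grids\<close>

lemma cutrk_le_decomposition_width:
  assumes "rank_decomposition G T L" "(s, t) \<in> adj T"
  shows "cutrk G (side G T L s t) \<le> decomposition_width G T L"
  unfolding decomposition_width_def
proof (rule Max_ge)
  have simp: "simple_graph T" using assms by (simp add: rank_decomposition_def is_tree_def)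
  then have "finite (verts T \<times> verts T)" by (simp add: simple_graph_def)
  moreover have "adj T \<subseteq> verts T \<times> verts T" using adj_vertsD[OF simp] by auto
  ultimately have "finite (adj T)" using finite_subset by blast
  moreover have "{cutrk G (side G T L s t) |s t. (s, t) \<in> adj T} =
      (\<lambda>(s, t). cutrk G (side G T L s t)) ` adj T" by auto
  ultimately show "finite {cutrk G (side G T L s t) |s t. (s, t) \<in> adj T}" by simp
qed (use assms in auto)

text \<open>The bound on \<open>k\<close> is that of \<open>balanced_tree_edge\<close> with
  \<open>B = 2 ^ q\<close>: if the cut-rank were at most \<open>q\<close>, more than
  \<open>2 ^ q\<close> comparators on one side would force a uniform row or column there.\<close>

lemma rankwidth_comparator_grid:
  assumes simp: "simple_graph G"
    and k: "3 * 2 ^ q + 2 \<le> (k :: nat)"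
    and cell: "\<And>i j. i < k \<Longrightarrow> j < k \<Longrightarrow> cell i j \<in> verts G"
    and r: "\<And>t. t < k \<Longrightarrow> r t \<in> verts G"
    and c: "\<And>t. t < k \<Longrightarrow> c t \<in> verts G"
    and adj_r: "\<And>i j t. i < k \<Longrightarrow> j < k \<Longrightarrow> t < k \<Longrightarrow> (cell i j, r t) \<in> adj G \<longleftrightarrow> i < t"
    and adj_c: "\<And>i j t. i < k \<Longrightarrow> j < k \<Longrightarrow> t < k \<Longrightarrow> (cell i j, c t) \<in> adj G \<longleftrightarrow> j < t"
  shows "q < rankwidth G"
proof -
  have fin: "finite (verts G)" using simp by (simp add: simple_graph_def)
  \<comment> \<open>A cell of row \<open>i\<close> tells the comparators apart, so there are exactly
    \<open>k\<close> of them to balance.\<close>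
  have "r i \<noteq> r j" if "i < j" "j < k" for i j
    using adj_r[of i 0 i] adj_r[of i 0 j] that by auto
  then have inj: "inj_on r {..<k}" by (intro linorder_inj_onI) auto
  define W where "W = r ` {..<k}"
  have W: "finite W" "W \<subseteq> verts G" "card W = k"
    using r inj by (auto simp: W_def card_image)
  have card: "2 \<le> card (verts G)" using card_mono[OF fin W(2)] W(3) k by linarith
  have "q < decomposition_width G T L" if dec: "rank_decomposition G T L" for T L
  proof (rule ccontr)
    assume *: "\<not> ?thesis"
    obtain s t where st: "(s, t) \<in> adj T" "(2::nat) ^ q < card (W \<inter> side G T L s t)"
      "(2::nat) ^ q < card (W - side G T L s t)"
      using balanced_tree_edge[OF dec W(1,2), of "2 ^ q"] W(3) k by auto
    define X where "X = side G T L s t"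
    have X: "X \<subseteq> verts G" by (auto simp: X_def side_def)
    have "cutrk G X \<le> q"
      using cutrk_le_decomposition_width[OF dec st(1)] * by (simp add: X_def)
    then have rk: "2 ^ cutrk G X \<le> (2 :: nat) ^ q" by (rule power_increasing) simp
    \<comment> \<open>By balance this holds for both values of \<open>b\<close>: each side contains
      an entire row.\<close>
    have row: "\<exists>i<k. \<forall>j<k. cell i j \<in> X \<longleftrightarrow> b" for b
    proof (rule uniform_row[OF fin X cell r adj_r])
      have sub: "(if b then W \<inter> X else W - X) \<subseteq> r ` {t. t < k \<and> (r t \<in> X \<longleftrightarrow> b)}"
        by (auto simp: W_def)
      have "2 ^ cutrk G X < card (if b then W \<inter> X else W - X)"
        using le_less_trans[OF rk st(2)] le_less_trans[OF rk st(3)] by (simp add: X_def)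
      also have "\<dots> \<le> card (r ` {t. t < k \<and> (r t \<in> X \<longleftrightarrow> b)})"
        using sub by (rule card_mono[rotated]) simp
      also have "\<dots> \<le> card {t. t < k \<and> (r t \<in> X \<longleftrightarrow> b)}" by (rule card_image_le) simp
      finally show "2 ^ cutrk G X < card {t. t < k \<and> (r t \<in> X \<longleftrightarrow> b)}" .
    qed
    \<comment> \<open>For columns one side is enough, and the pigeonhole principle gives it from
      \<open>k > 2 * 2 ^ q\<close>.\<close>
    have "\<exists>b. (2::nat) ^ q < card {t. t < k \<and> (c t \<in> X \<longleftrightarrow> b)}"
    proof (rule ccontr)
      assume "\<not> ?thesis"
      then have le: "card {t. t < k \<and> (c t \<in> X \<longleftrightarrow> b)} \<le> 2 ^ q" for b by (auto simp: not_less)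
      have "{..<k} = {t. t < k \<and> (c t \<in> X \<longleftrightarrow> True)} \<union> {t. t < k \<and> (c t \<in> X \<longleftrightarrow> False)}"
        by auto
      then have "k \<le> card {t. t < k \<and> (c t \<in> X \<longleftrightarrow> True)} + card {t. t < k \<and> (c t \<in> X \<longleftrightarrow> False)}"
        by (metis card_Un_le card_lessThan)
      then show False using k le[of True] le[of False] by linarith
    qed
    then obtain b where b: "(2::nat) ^ q < card {t. t < k \<and> (c t \<in> X \<longleftrightarrow> b)}" by blast
    have "\<exists>j<k. \<forall>i<k. cell i j \<in> X \<longleftrightarrow> b"
      by (rule uniform_row[OF fin X, of k "\<lambda>i j. cell j i" c]) (use cell c adj_c le_less_trans[OF rk b] in simp_all)
    then obtain j where "j < k" "\<And>i. i < k \<Longrightarrow> cell i j \<in> X \<longleftrightarrow> b" by blast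
    \<comment> \<open>The uniform column on side \<open>b\<close> and the uniform row on the other
      side share a cell.\<close>
    then show False using row[of "\<not> b"] by blast
  qed
  moreover obtain T L where "rank_decomposition G T L"
    using rank_decomposition_exists[OF fin card] by blast
  then have "Inf {decomposition_width G T L |T L. rank_decomposition G T L}
      \<in> {decomposition_width G T L |T L. rank_decomposition G T L}"
    by (intro Inf_nat_def1) auto
  ultimately show ?thesis using card by (auto simp: rankwidth_def)
qed


section \<open>Graphs on pairs\<close>

definition pairs :: "nat \<Rightarrow> (nat \<times> nat) set" where
  "pairs m = {(a, b). a < b \<and> b < m}"

text \<open>Pairs are encoded as numbers because the graph classes of the theorem have vertices of
  type \<open>nat\<close>.\<close>

definition pair_graph :: "nat \<Rightarrow> (nat \<times> nat \<Rightarrow> nat \<times> nat \<Rightarrow> bool) \<Rightarrow> nat ugraph" where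
  "pair_graph m E = \<lparr>verts = prod_encode ` pairs m,
     edges = {{prod_encode x, prod_encode y} |x y. x \<in> pairs m \<and> y \<in> pairs m \<and> E x y}\<rparr>"

lemma finite_pairs: "finite (pairs m)"
  by (rule finite_subset[of _ "{..<m} \<times> {..<m}"]) (auto simp: pairs_def)

lemma simple_pair_graph:
  assumes "irreflp E"
  shows "simple_graph (pair_graph m E)"
proof -
  have "card {prod_encode x, prod_encode y} = 2" if "E x y" for x y
    using that assms by (cases "x = y") (auto dest: irreflpD)
  then show ?thesis using finite_pairs[of m] by (auto simp: simple_graph_def pair_graph_def)
qed

lemma edge_pair_graph:
  assumes "symp E" "x \<in> pairs m" "y \<in> pairs m"
  shows "{prod_encode x, prod_encode y} \<in> edges (pair_graph m E) \<longleftrightarrow> E x y"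
proof
  assume "{prod_encode x, prod_encode y} \<in> edges (pair_graph m E)"
  then obtain x' y' where "{prod_encode x, prod_encode y} = {prod_encode x', prod_encode y'}" "E x' y'"
    unfolding pair_graph_def by force
  then have "x = x' \<and> y = y' \<or> x = y' \<and> y = x'" by (simp add: doubleton_eq_iff)
  then show "E x y" using \<open>E x' y'\<close> sympD[OF assms(1)] by blast
next
  assume "E x y"
  then have "\<exists>x' y'. {prod_encode x, prod_encode y} = {prod_encode x', prod_encode y'} \<and>
      x' \<in> pairs m \<and> y' \<in> pairs m \<and> E x' y'" using assms(2,3) by blast
  then show "{prod_encode x, prod_encode y} \<in> edges (pair_graph m E)"
    unfolding pair_graph_def by simp
qed

text \<open>Ramsey's theorem for two-element sets with \<open>N\<close> colors; \<open>e\<close>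
  enumerates the homogeneous set increasingly, so it carries pairs to pairs.\<close>

lemma monochromatic_pairs:
  fixes N n :: nat
  shows "\<exists>m. \<forall>f :: nat \<times> nat \<Rightarrow> nat. f ` pairs m \<subseteq> {..<N} \<longrightarrow>
    (\<exists>e i. strict_mono_on {..<n} e \<and> (\<forall>x\<in>pairs n. map_prod e e x \<in> pairs m \<and> f (map_prod e e x) = i))"
proof -
  obtain m :: nat where m: "partn_lst {..<m} (replicate N n) 2" using ramsey_full by blast
  have "\<exists>e i. strict_mono_on {..<n} e \<and> (\<forall>x\<in>pairs n. map_prod e e x \<in> pairs m \<and> f (map_prod e e x) = i)"
    if f: "f ` pairs m \<subseteq> {..<N}" for f :: "nat \<times> nat \<Rightarrow> nat"
  proof -
    \<comment> \<open>An increasing pair is recovered from its underlying two-element set.\<close>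
    define g where "g = (\<lambda>S. f (Min S, Max S))"
    have g: "g {a, b} = f (a, b)" if "a < b" for a b using that by (simp add: g_def min_def max_def)
    have "g \<in> nsets {..<m} 2 \<rightarrow> {..<length (replicate N n)}"
    proof
      fix S assume "S \<in> nsets {..<m} 2"
      then obtain x y where S: "S = {x, y}" "x < m" "y < m" "x \<noteq> y" by (auto elim: nsets2_E)
      consider "x < y" | "y < x" using S(4) by linarith
      then have "\<exists>a b. (a, b) \<in> pairs m \<and> g S = f (a, b)"
      proof cases
        case 1
        then show ?thesis using S g[of x y] by (auto simp: pairs_def)
      next
        case 2
        then show ?thesis using S g[of y x] by (auto simp: pairs_def insert_commute)
      qed
      then show "g S \<in> {..<length (replicate N n)}" using f by auto
    qed
    then obtain i where "i < N" "monochromatic {..<m} n 2 g i"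
      using m unfolding partn_lst_def by fastforce
    then obtain H where H: "H \<in> nsets {..<m} n" "g ` nsets H 2 \<subseteq> {i}"
      unfolding monochromatic_def by blast
    then have "finite H" "card H = n" "H \<subseteq> {..<m}" by (auto simp: nsets_def)
    then obtain e where e: "bij_betw e {..<n} H" "strict_mono_on {..<n} e"
      using ex_bij_betw_strict_mono_card by metis
    have "e a < e b \<and> e b < m \<and> f (e a, e b) = i" if "a < b" "b < n" for a b
    proof -
      have ab: "e a < e b" using e(2) that by (auto simp: strict_mono_on_def)
      moreover have "e a \<in> H" "e b \<in> H" using e(1) that by (auto simp: bij_betw_def)
      ultimately have "{e a, e b} \<in> nsets H 2" by (auto simp: nsets_def)
      then have "g {e a, e b} \<in> {i}" using H(2) by blast
      then show ?thesis using g[OF ab] ab \<open>e b \<in> H\<close> \<open>H \<subseteq> {..<m}\<close> by auto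
    qed
    then show ?thesis using e(2) by (intro exI[of _ e] exI[of _ i]) (auto simp: pairs_def)
  qed
  then show ?thesis by blast
qed

text \<open>The case \<open>p = 1\<close> is refuted. Ramsey's theorem gives no control over the
  embedding \<open>e\<close>, so the adjacencies of the grid on \<open>n k\<close> points are
  required for every strictly increasing \<open>e\<close>.\<close>

lemma not_admits_low_rankwidth_colorings:
  fixes n :: "nat \<Rightarrow> nat" and cell :: "nat \<Rightarrow> nat \<Rightarrow> nat \<Rightarrow> nat \<times> nat"
    and r c :: "nat \<Rightarrow> nat \<Rightarrow> nat \<times> nat"
  assumes D: "\<And>m. pair_graph m E \<in> D"
    and E: "irreflp E" "symp E"
    and cell: "\<And>k i j. i < k \<Longrightarrow> j < k \<Longrightarrow> cell k i j \<in> pairs (n k)"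
    and r: "\<And>k t. t < k \<Longrightarrow> r k t \<in> pairs (n k)"
    and c: "\<And>k t. t < k \<Longrightarrow> c k t \<in> pairs (n k)"
    and adj_r: "\<And>e k i j t. strict_mono_on {..<n k} e \<Longrightarrow> i < k \<Longrightarrow> j < k \<Longrightarrow> t < k \<Longrightarrow>
      E (map_prod e e (cell k i j)) (map_prod e e (r k t)) \<longleftrightarrow> i < t"
    and adj_c: "\<And>e k i j t. strict_mono_on {..<n k} e \<Longrightarrow> i < k \<Longrightarrow> j < k \<Longrightarrow> t < k \<Longrightarrow>
      E (map_prod e e (cell k i j)) (map_prod e e (c k t)) \<longleftrightarrow> j < t"
  shows "\<not> admits_low_rankwidth_colorings D"
proof
  assume "admits_low_rankwidth_colorings D"
  then obtain N Q where NQ: "\<And>p G. G \<in> D \<Longrightarrow> \<exists>c :: nat \<Rightarrow> nat. card (c ` verts G) \<le> N p \<and>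
      (\<forall>I \<subseteq> c ` verts G. card I \<le> p \<longrightarrow> rankwidth (induced G {v \<in> verts G. c v \<in> I}) \<le> Q (card I))"
    unfolding admits_low_rankwidth_colorings_def by blast
  define k :: nat where "k = 3 * 2 ^ Q 1 + 2"
  obtain m where m: "\<And>f :: nat \<times> nat \<Rightarrow> nat. f ` pairs m \<subseteq> {..<N 1} \<Longrightarrow>
    \<exists>e i. strict_mono_on {..<n k} e \<and>
      (\<forall>x\<in>pairs (n k). map_prod e e x \<in> pairs m \<and> f (map_prod e e x) = i)"
    using monochromatic_pairs[of "N 1" "n k"] by blast
  define G where "G = pair_graph m E"
  have simp: "simple_graph G" unfolding G_def by (rule simple_pair_graph[OF E(1)])
  have verts: "verts G = prod_encode ` pairs m" by (simp add: G_def pair_graph_def)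
  have "\<exists>c :: nat \<Rightarrow> nat. card (c ` verts G) \<le> N 1 \<and>
      (\<forall>I \<subseteq> c ` verts G. card I \<le> 1 \<longrightarrow> rankwidth (induced G {v \<in> verts G. c v \<in> I}) \<le> Q (card I))"
    unfolding G_def by (rule NQ[OF D])
  then obtain col :: "nat \<Rightarrow> nat" where col: "card (col ` verts G) \<le> N 1"
    "\<forall>I \<subseteq> col ` verts G. card I \<le> 1 \<longrightarrow>
      rankwidth (induced G {v \<in> verts G. col v \<in> I}) \<le> Q (card I)"
    by blast
  have "finite (col ` verts G)" using simp by (simp add: simple_graph_def)
  \<comment> \<open>The used colors are few but arbitrary numbers; \<open>g\<close> renumbers them
    below \<open>N 1\<close>.\<close>
  then obtain g where g: "bij_betw g (col ` verts G) {0..<card (col ` verts G)}"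
    using ex_bij_betw_finite_nat by blast
  have "(\<lambda>x. g (col (prod_encode x))) ` pairs m \<subseteq> {..<N 1}"
  proof
    fix y assume "y \<in> (\<lambda>x. g (col (prod_encode x))) ` pairs m"
    then have "y \<in> g ` col ` verts G" by (auto simp: verts)
    then show "y \<in> {..<N 1}" using g col(1) by (auto simp: bij_betw_def)
  qed
  from m[OF this] obtain e i0 where e: "strict_mono_on {..<n k} e"
    and ex: "\<And>x. x \<in> pairs (n k) \<Longrightarrow> map_prod e e x \<in> pairs m"
    and mono: "\<And>x. x \<in> pairs (n k) \<Longrightarrow> g (col (prod_encode (map_prod e e x))) = i0"
    by blast
  have "0 < k" by (simp add: k_def)
  note r0 = r[OF this]
  \<comment> \<open>The original color behind \<open>i0\<close>, read off from one vertex of the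
    grid; injectivity of \<open>g\<close> extends it to all others.\<close>
  define z where "z = col (prod_encode (map_prod e e (r k 0)))"
  have z: "z \<in> col ` verts G" using ex[OF r0] by (auto simp: z_def verts)
  have colz: "col (prod_encode (map_prod e e x)) = z" if x: "x \<in> pairs (n k)" for x
  proof -
    have "inj_on g (col ` verts G)" using g by (simp add: bij_betw_def)
    then show ?thesis
      by (rule inj_onD) (use mono[OF x] mono[OF r0] ex[OF x] z in \<open>auto simp: z_def verts\<close>)
  qed
  define H where "H = induced G {v \<in> verts G. col v \<in> {z}}"
  have vH: "verts H = {v \<in> verts G. col v = z}" by (auto simp: H_def induced_def)
  have simpH: "simple_graph H"
    using simp by (auto simp: simple_graph_def H_def induced_def)
  have vert: "prod_encode (map_prod e e x) \<in> verts H" if "x \<in> pairs (n k)" for x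
    using that ex colz by (auto simp: vH verts)
  have adj: "(prod_encode (map_prod e e x), prod_encode (map_prod e e y)) \<in> adj H \<longleftrightarrow>
      E (map_prod e e x) (map_prod e e y)" if "x \<in> pairs (n k)" "y \<in> pairs (n k)" for x y
    using edge_pair_graph[OF E(2) ex[OF that(1)] ex[OF that(2)]] vert[OF that(1)] vert[OF that(2)]
    by (auto simp: adj_def H_def induced_def G_def)
  have "Q 1 < rankwidth H"
  proof (rule rankwidth_comparator_grid[OF simpH,
        where k = k and cell = "\<lambda>i j. prod_encode (map_prod e e (cell k i j))"
        and r = "\<lambda>t. prod_encode (map_prod e e (r k t))" and c = "\<lambda>t. prod_encode (map_prod e e (c k t))"])
    show "3 * 2 ^ Q 1 + 2 \<le> k" by (simp add: k_def)
  qed (use vert cell r c adj adj_r[OF e] adj_c[OF e] in simp_all)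
  moreover have "rankwidth H \<le> Q 1" using col(2)[rule_format, of "{z}"] z by (simp add: H_def)
  ultimately show False by simp
qed

section \<open>Interval graphs on pairs\<close>

definition interval_overlap :: "nat \<times> nat \<Rightarrow> nat \<times> nat \<Rightarrow> bool" where
  "interval_overlap x y \<longleftrightarrow> x \<noteq> y \<and> fst x \<le> snd y \<and> fst y \<le> snd x"

lemma interval_graph_pair_graph: "interval_graph (pair_graph m interval_overlap)"
proof -
  have E: "irreflp interval_overlap" "symp interval_overlap"
    by (auto simp: interval_overlap_def irreflp_def symp_def)
  define I where "I = (\<lambda>v. {real (fst (prod_decode v))..real (snd (prod_decode v))})"
  have "is_intersection_graph (pair_graph m interval_overlap) I"
    unfolding is_intersection_graph_def
  proof (intro ballI impI)
    fix u v assume "u \<in> verts (pair_graph m interval_overlap)" "v \<in> verts (pair_graph m interval_overlap)"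
      and "u \<noteq> v"
    then obtain a b a' b' where u: "u = prod_encode (a, b)" "(a, b) \<in> pairs m"
      and v: "v = prod_encode (a', b')" "(a', b') \<in> pairs m"
      by (auto simp: pair_graph_def)
    have "I u \<inter> I v \<noteq> {} \<longleftrightarrow> a \<le> b' \<and> a' \<le> b"
      using u v by (auto simp: I_def pairs_def)
    then show "{u, v} \<in> edges (pair_graph m interval_overlap) \<longleftrightarrow> I u \<inter> I v \<noteq> {}"
      using edge_pair_graph[OF E(2) u(2) v(2)] u v \<open>u \<noteq> v\<close> by (auto simp: interval_overlap_def)
  qed
  moreover have "\<forall>v\<in>verts (pair_graph m interval_overlap). is_interval (I v) \<and> I v \<noteq> {}"
    by (auto simp: I_def pair_graph_def pairs_def is_interval_cc)
  ultimately show ?thesis using simple_pair_graph[OF E(1)] by (auto simp: interval_graph_def)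
qed

section \<open>Permutation graphs on pairs\<close>

definition inversion :: "nat \<times> nat \<Rightarrow> nat \<times> nat \<Rightarrow> bool" where
  "inversion x y \<longleftrightarrow> fst x < fst y \<and> snd y < snd x \<or> fst y < fst x \<and> snd x < snd y"

lemma lex_less_iff:
  fixes a b a' b' m :: nat
  assumes "b < m" "b' < m"
  shows "a * m + b < a' * m + b' \<longleftrightarrow> a < a' \<or> a = a' \<and> b < b'"
proof -
  have *: "c * m + d < c' * m + d'" if "c < c'" "d < m" for c c' d d' :: nat
  proof -
    have "Suc c * m \<le> c' * m" using that(1) by (intro mult_right_mono) auto
    then show ?thesis using that(2) by simp
  qed
  show ?thesis
    using *[of a a' b b'] *[of a' a b' b] assms by (cases a a' rule: linorder_cases) auto
qed

text \<open>The segment parameter \<open>t\<close> is the height of the point, so two segments can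
  meet only at equal parameters.\<close>

lemma mem_segment_between_lines:
  fixes a b :: real
  shows "z \<in> closed_segment ((0, 0) + a *\<^sub>R (1, 0)) ((0, 1) + b *\<^sub>R (1, 0)) \<longleftrightarrow>
    (\<exists>t. 0 \<le> t \<and> t \<le> 1 \<and> z = ((1 - t) * a + t * b, t :: real))"
proof -
  have "(1 - t) *\<^sub>R ((0, 0) + a *\<^sub>R (1, 0)) + t *\<^sub>R ((0, 1) + b *\<^sub>R (1, 0)) = ((1 - t) * a + t * b, t)"
    for t :: real by simp
  then show ?thesis by (simp only: closed_segment_def mem_Collect_eq conj_ac)
qed

text \<open>At height \<open>t\<close> the horizontal distance is affine in \<open>t\<close>,
  running from \<open>a - a'\<close> to \<open>b - b'\<close>. It vanishes somewhere on the unit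
  interval unless both ends have the same strict sign.\<close>

lemma segments_meet_iff:
  fixes a b a' b' :: real
  shows "closed_segment ((0, 0) + a *\<^sub>R (1 :: real, 0 :: real)) ((0, 1) + b *\<^sub>R (1 :: real, 0 :: real)) \<inter>
    closed_segment ((0, 0) + a' *\<^sub>R (1 :: real, 0 :: real)) ((0, 1) + b' *\<^sub>R (1 :: real, 0 :: real)) \<noteq> {} \<longleftrightarrow>
    (a - a') * (b - b') \<le> 0" (is "?S \<inter> ?S' \<noteq> {} \<longleftrightarrow> ?R")
proof
  assume "?S \<inter> ?S' \<noteq> {}"
  then obtain z where "z \<in> ?S" "z \<in> ?S'" by (metis disjoint_iff)
  then obtain t where t: "0 \<le> t" "t \<le> 1" "(1 - t) * a + t * b = (1 - t) * a' + t * b'"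
    unfolding mem_segment_between_lines by auto
  show ?R
  proof (rule ccontr)
    assume "\<not> ?R"
    then have "0 < (a - a') \<and> 0 < b - b' \<or> a - a' < 0 \<and> b - b' < 0"
      by (simp add: not_le zero_less_mult_iff)
    moreover have eq: "(1 - t) * (a - a') + t * (b - b') = 0" using t(3) by (simp add: algebra_simps)
    ultimately consider "0 < a - a'" "0 < b - b'" | "0 < a' - a" "0 < b' - b" by auto
    then show False
    proof cases
      case 1
      then have "0 < (1 - t) * (a - a') + t * (b - b')"
        using t by (cases "t = 0") (auto intro: add_nonneg_pos)
      then show False using eq by simp
    next
      case 2
      then have "0 < (1 - t) * (a' - a) + t * (b' - b)"
        using t by (cases "t = 0") (auto intro: add_nonneg_pos)
      then show False using eq by (simp add: algebra_simps)
    qed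
  qed
next
  assume R: ?R
  have "\<exists>t. 0 \<le> t \<and> t \<le> 1 \<and> (1 - t) * a + t * b = (1 - t) * a' + t * b'"
  proof (cases "a - a' = b - b'")
    case True
    then have "a = a'" "b = b'" using R by (auto simp: mult_le_0_iff)
    then show ?thesis by (intro exI[of _ 0]) simp
  next
    case False
    \<comment> \<open>The zero of this affine function; the excluded case of equal differences is
      the one with denominator 0.\<close>
    define t where "t = (a - a') / ((a - a') - (b - b'))"
    have "0 \<le> t" "t \<le> 1" using R False by (auto simp: t_def divide_simps mult_le_0_iff)
    moreover have "t * ((a - a') - (b - b')) = a - a'" using False by (simp add: t_def)
    then have "(1 - t) * a + t * b = (1 - t) * a' + t * b'" by (simp add: algebra_simps)
    ultimately show ?thesis by blast
  qed
  then obtain t where t: "0 \<le> t" "t \<le> 1" "(1 - t) * a + t * b = (1 - t) * a' + t * b'" by blast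
  have "((1 - t) * a + t * b, t) \<in> ?S" "((1 - t) * a' + t * b', t) \<in> ?S'"
    unfolding mem_segment_between_lines using t(1,2) by auto
  then show "?S \<inter> ?S' \<noteq> {}" using t(3) by (metis disjoint_iff)
qed

text \<open>The endpoints order the pairs lexicographically, once by first and once by second
  coordinate; pairs that share a coordinate are in the same order on both lines.\<close>

lemma permutation_graph_pair_graph: "permutation_graph (pair_graph m inversion)"
proof -
  have E: "irreflp inversion" "symp inversion"
    by (auto simp: inversion_def irreflp_def symp_def)
  define f where "f = (\<lambda>v. case prod_decode v of (a, b) \<Rightarrow> real (a * m + b))"
  define g where "g = (\<lambda>v. case prod_decode v of (a, b) \<Rightarrow> real (b * m + a))"
  have "is_intersection_graph (pair_graph m inversion)
    (\<lambda>v. closed_segment ((0, 0) + f v *\<^sub>R (1 :: real, 0 :: real)) ((0, 1) + g v *\<^sub>R (1 :: real, 0 :: real)))"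
    unfolding is_intersection_graph_def segments_meet_iff
  proof (intro ballI impI)
    fix u v assume "u \<in> verts (pair_graph m inversion)" "v \<in> verts (pair_graph m inversion)"
      and "u \<noteq> v"
    then obtain a b a' b' where u: "u = prod_encode (a, b)" "(a, b) \<in> pairs m"
      and v: "v = prod_encode (a', b')" "(a', b') \<in> pairs m"
      by (auto simp: pair_graph_def)
    have lt: "a < m" "b < m" "a' < m" "b' < m" using u v by (auto simp: pairs_def)
    have f: "f u < f v \<longleftrightarrow> a < a' \<or> a = a' \<and> b < b'" "f v < f u \<longleftrightarrow> a' < a \<or> a' = a \<and> b' < b"
      using lt by (simp_all add: f_def u v lex_less_iff del: of_nat_add of_nat_mult)
    have g: "g u < g v \<longleftrightarrow> b < b' \<or> b = b' \<and> a < a'" "g v < g u \<longleftrightarrow> b' < b \<or> b' = b \<and> a' < a"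
      using lt by (simp_all add: g_def u v lex_less_iff del: of_nat_add of_nat_mult)
    \<comment> \<open>Distinct pairs differ on both lines, so the product is never 0 and the
      segments never meet at an endpoint.\<close>
    have "(a, b) \<noteq> (a', b')" using \<open>u \<noteq> v\<close> u v by auto
    moreover have "0 < (f u - f v) * (g u - g v) \<longleftrightarrow> f v < f u \<and> g v < g u \<or> f u < f v \<and> g u < g v"
      by (auto simp: zero_less_mult_iff)
    ultimately have "\<not> 0 < (f u - f v) * (g u - g v) \<longleftrightarrow> inversion (a, b) (a', b')"
      unfolding f g inversion_def fst_conv snd_conv prod.inject by linarith
    then have "(f u - f v) * (g u - g v) \<le> 0 \<longleftrightarrow> inversion (a, b) (a', b')"
      by (simp only: not_less)
    then show "{u, v} \<in> edges (pair_graph m inversion) \<longleftrightarrow> (f u - f v) * (g u - g v) \<le> 0"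
      using edge_pair_graph[OF E(2) u(2) v(2)] u v by simp
  qed
  moreover have "(0, 1) - (0, 0) \<notin> span {(1, 0) :: real \<times> real}" by (auto simp: span_singleton)
  moreover have "(1, 0) \<noteq> (0 :: real \<times> real)" by (simp add: zero_prod_def)
  ultimately show ?thesis
    using simple_pair_graph[OF E(1)] unfolding permutation_graph_def by blast
qed

theorem theorem7:
  shows "\<not> admits_low_rankwidth_colorings {G :: nat ugraph. interval_graph G} \<and>
         \<not> admits_low_rankwidth_colorings {G :: nat ugraph. permutation_graph G}"
proof
  show "\<not> admits_low_rankwidth_colorings {G :: nat ugraph. interval_graph G}"
  \<comment> \<open>The left end of a cell encodes its row and the right end its column. Row
    comparators reach in from the far left and column comparators from the far right. The offsets
    make \<open>i + 2 \<le> t + 1\<close> equivalent to \<open>i < t\<close>, and likewise for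
    columns.\<close>
  proof (rule not_admits_low_rankwidth_colorings[where E = interval_overlap and n = "\<lambda>k. 2 * k + 5"
        and cell = "\<lambda>k i j. (i + 2, 2 * k + 2 - j)" and r = "\<lambda>k t. (0, t + 1)"
        and c = "\<lambda>k t. (2 * k + 3 - t, 2 * k + 4)"])
    fix e :: "nat \<Rightarrow> nat" and k i j t :: nat
    assume e: "strict_mono_on {..<2 * k + 5} e" and lt: "i < k" "j < k" "t < k"
    have le: "e x \<le> e y \<longleftrightarrow> x \<le> y" "e x = e y \<longleftrightarrow> x = y" if "x < 2 * k + 5" "y < 2 * k + 5" for x y
      using e that by (auto simp: strict_mono_on_less_eq strict_mono_on_eq)
    show "interval_overlap (map_prod e e (i + 2, 2 * k + 2 - j)) (map_prod e e (0, t + 1)) \<longleftrightarrow> i < t"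
      using lt by (auto simp: interval_overlap_def le)
    show "interval_overlap (map_prod e e (i + 2, 2 * k + 2 - j))
        (map_prod e e (2 * k + 3 - t, 2 * k + 4)) \<longleftrightarrow> j < t"
      using lt by (auto simp: interval_overlap_def le)
  qed (auto simp: interval_graph_pair_graph pairs_def interval_overlap_def irreflp_def symp_def)
  show "\<not> admits_low_rankwidth_colorings {G :: nat ugraph. permutation_graph G}"
  \<comment> \<open>Cells form a grid of points. Row comparators lie below all of them, so only
    first coordinates decide an inversion; column comparators lie to the left, so only second
    coordinates do.\<close>
  proof (rule not_admits_low_rankwidth_colorings[where E = inversion and n = "\<lambda>k. 2 * k + 2"
        and cell = "\<lambda>k i j. (i + 1, k + 2 + j)" and r = "\<lambda>k t. (t + 1, k + 1)"
        and c = "\<lambda>k t. (0, k + 2 + t)"])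
    fix e :: "nat \<Rightarrow> nat" and k i j t :: nat
    assume e: "strict_mono_on {..<2 * k + 2} e" and lt: "i < k" "j < k" "t < k"
    have less: "e x < e y \<longleftrightarrow> x < y" if "x < 2 * k + 2" "y < 2 * k + 2" for x y
      using e that by (auto simp: strict_mono_on_less)
    show "inversion (map_prod e e (i + 1, k + 2 + j)) (map_prod e e (t + 1, k + 1)) \<longleftrightarrow> i < t"
      using lt by (auto simp: inversion_def less)
    show "inversion (map_prod e e (i + 1, k + 2 + j)) (map_prod e e (0, k + 2 + t)) \<longleftrightarrow> j < t"
      using lt by (auto simp: inversion_def less)
  qed (auto simp: permutation_graph_pair_graph pairs_def inversion_def irreflp_def symp_def)
qed

end
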